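(* Let $R\to S$ be a ring homomorphism. Then it is a weak content algebra if and only if it is a power-content algebra such that for all ideals $I,J$ of $S$ we have $c(I)\cap c(J)\subseteq\sqrt{c(I\cap J)}$.
   Context: All rings are commutative with identity. For a ring homomorphism $R\to S$ and $f\in S$, the (Ohm-Rush) content of $f$ is the ideal $c(f):=\bigcap\{I\subseteq R \text{ ideal} \mid f\in IS\}$ of $R$. The algebra $R\to S$ is Ohm-Rush if $f\in c(f)S$ for all $f\in S$. For an Ohm-Rush algebra $R\to S$ and an ideal $J$ of $S$, set $c(J):=\bigcap\{I\subseteq R\text{ ideal}\mid J\subseteq IS\}$. A weak content algebra is an Ohm-Rush algebra $R\to S$ such that $\sqrt{c(fg)}=\sqrt{c(f)c(g)}$ for all $f,g\in S$. A power-content algebra is an Ohm-Rush algebra $R\to S$ such that $c(\sqrt J)\subseteq\sqrt{c(J)}$ for every ideal $J$ of $S$. *)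

theory Defs
  imports "HOL-Algebra.Algebra"
begin

text \<open>
  Rings are the locale-based commutative rings of HOL-Algebra, so the zero ring is included. An
  algebra \<open>R \<rightarrow> S\<close> is given by a homomorphism \<open>h\<close>, as in \<^locale>\<open>ring_hom_cring\<close>.
\<close>

definition radical :: "('a, 'm) ring_scheme \<Rightarrow> 'a set \<Rightarrow> 'a set"
  where "radical R I = {x \<in> carrier R. \<exists>n::nat. n > 0 \<and> x [^]\<^bsub>R\<^esub> n \<in> I}"

text \<open>The extension \<open>IS\<close>, i.e. the ideal of \<open>S\<close> generated by \<open>h(I)\<close>.\<close>

definition ideal_ext :: "('b, 'n) ring_scheme \<Rightarrow> ('a \<Rightarrow> 'b) \<Rightarrow> 'a set \<Rightarrow> 'b set"
  where "ideal_ext S h I = genideal S (h ` I)"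

text \<open>
  The families intersected below are nonempty for \<open>f \<in> S\<close> and \<open>J \<subseteq> S\<close>: they contain
  \<open>I = R\<close>, since \<open>RS = S\<close>. Hence both contents are ideals of \<open>R\<close>.
\<close>

definition content ::
    "('a, 'm) ring_scheme \<Rightarrow> ('b, 'n) ring_scheme \<Rightarrow> ('a \<Rightarrow> 'b) \<Rightarrow> 'b \<Rightarrow> 'a set"
  where "content R S h f = \<Inter> {I. ideal I R \<and> f \<in> ideal_ext S h I}"

definition content_ideal ::
    "('a, 'm) ring_scheme \<Rightarrow> ('b, 'n) ring_scheme \<Rightarrow> ('a \<Rightarrow> 'b) \<Rightarrow> 'b set \<Rightarrow> 'a set"
  where "content_ideal R S h J = \<Inter> {I. ideal I R \<and> J \<subseteq> ideal_ext S h I}"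

locale ohm_rush_algebra = ring_hom_cring +
  assumes mem_content_ext: "f \<in> carrier S \<Longrightarrow> f \<in> ideal_ext S h (content R S h f)"

locale weak_content_algebra = ohm_rush_algebra +
  assumes radical_content_mult:
    "\<lbrakk>f \<in> carrier S; g \<in> carrier S\<rbrakk> \<Longrightarrow>
      radical R (content R S h (f \<otimes>\<^bsub>S\<^esub> g)) =
      radical R (ideal_prod R (content R S h f) (content R S h g))"

locale power_content_algebra = ohm_rush_algebra +
  assumes content_radical_subset:
    "ideal J S \<Longrightarrow> content_ideal R S h (radical S J) \<subseteq> radical R (content_ideal R S h J)"

end

theory Submission
  imports Defs
begin

text \<open>
  In an Ohm-Rush algebra \<open>c(J)\<close> is the least ideal containing all \<open>c(f)\<close> with \<open>f \<in> J\<close>, and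
  \<open>c(fS) = c(f)\<close>. If the algebra is weak content, then \<open>c(f)c(g) \<subseteq> \<surd>c(fg)\<close> for \<open>f \<in> I\<close> and \<open>g \<in> J\<close>
  gives \<open>c(I)c(J) \<subseteq> \<surd>c(I \<inter> J)\<close>, and iterating it gives \<open>c(f) \<subseteq> \<surd>c(f^n)\<close>. Conversely,
  \<open>c(f) \<inter> c(g) \<subseteq> \<surd>c(fS \<inter> gS)\<close>, where \<open>fS \<inter> gS \<subseteq> \<surd>(fgS)\<close> because the square of a common
  multiple of \<open>f\<close> and \<open>g\<close> is a multiple of \<open>fg\<close>.
\<close>

section \<open>Radicals of ideals in a commutative ring\<close>

lemma radicalI:
  "x \<in> carrier R \<Longrightarrow> n > 0 \<Longrightarrow> x [^]\<^bsub>R\<^esub> (n::nat) \<in> I \<Longrightarrow> x \<in> radical R I"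
  unfolding radical_def by blast

lemma radicalE:
  assumes "x \<in> radical R I"
  obtains n :: nat where "x \<in> carrier R" "n > 0" "x [^]\<^bsub>R\<^esub> n \<in> I"
  using assms unfolding radical_def by blast

lemma radical_mono: "I \<subseteq> J \<Longrightarrow> radical R I \<subseteq> radical R J"
  unfolding radical_def by blast

lemma (in ring) radical_radical: "radical R (radical R I) \<subseteq> radical R I"
proof
  fix x assume "x \<in> radical R (radical R I)"
  then obtain m where m: "x \<in> carrier R" "m > 0" "x [^] (m::nat) \<in> radical R I"
    by (rule radicalE)
  from m(3) obtain n where n: "n > 0" "(x [^] m) [^] (n::nat) \<in> I"
    by (rule radicalE)
  show "x \<in> radical R I"
    by (rule radicalI[of _ _ "m * n"]) (use m n in \<open>auto simp: nat_pow_pow\<close>)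
qed

lemma (in ring) radical_pow_mem:
  assumes "x \<in> carrier R" "x [^] (n::nat) \<in> radical R I" "n > 0"
  shows "x \<in> radical R I"
  using radicalI[of x R n "radical R I"] assms radical_radical by blast

lemma (in cring) subset_radical:
  assumes "ideal I R"
  shows "I \<subseteq> radical R I"
proof
  fix x assume "x \<in> I"
  with assms show "x \<in> radical R I"
    by (intro radicalI[of _ _ 1]) (auto simp: ideal.Icarr)
qed

lemma (in cring) ideal_pow_mono:
  assumes "ideal I R" "x \<in> carrier R" "x [^] (n::nat) \<in> I" "n \<le> m"
  shows "x [^] m \<in> I"
proof -
  have "x [^] m = x [^] (m - n) \<otimes> x [^] n"
    using assms by (simp add: nat_pow_mult)
  thus ?thesis using assms by (simp add: ideal.I_l_closed)
qed

text \<open>The powers of \<open>x\<close> and \<open>y\<close> are carried along so that no binomial expansion is needed.\<close>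

lemma (in cring) ideal_pow_add:
  assumes I: "ideal I R" and x: "x \<in> carrier R" and y: "y \<in> carrier R"
    and xn: "x [^] (n::nat) \<in> I" and ym: "y [^] (m::nat) \<in> I"
  shows "n + m \<le> i + j + k \<Longrightarrow> x [^] (i::nat) \<otimes> y [^] (j::nat) \<otimes> (x \<oplus> y) [^] (k::nat) \<in> I"
proof (induction k arbitrary: i j)
  case 0
  \<comment> \<open>Without a factor \<open>x \<oplus> y\<close>, the bound forces one of the two
    exponents to be large enough.\<close>
  then consider "n \<le> i" | "m \<le> j" by linarith
  thus ?case
  proof cases
    case 1
    from ideal_pow_mono[OF I x xn this] show ?thesis
      using I x y by (simp add: ideal.I_r_closed)
  next
    case 2
    from ideal_pow_mono[OF I y ym this] show ?thesis
      using I x y by (simp add: ideal.I_l_closed)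
  qed
next
  case (Suc k)
  let ?z = "(x \<oplus> y) [^] k"
  \<comment> \<open>One factor \<open>x \<oplus> y\<close> is split off and distributed. Each
    summand moves it into the power of \<open>x\<close> or of \<open>y\<close>, so the total degree
    is unchanged and the induction hypothesis applies to both.\<close>
  have "x [^] i \<otimes> y [^] j \<otimes> (x \<oplus> y) [^] Suc k
      = x [^] i \<otimes> y [^] j \<otimes> (?z \<otimes> x) \<oplus> x [^] i \<otimes> y [^] j \<otimes> (?z \<otimes> y)"
    using x y by (simp add: r_distr)
  also have "x [^] i \<otimes> y [^] j \<otimes> (?z \<otimes> x) = x [^] Suc i \<otimes> y [^] j \<otimes> ?z"
    using x y by (simp add: m_ac)
  also have "x [^] i \<otimes> y [^] j \<otimes> (?z \<otimes> y) = x [^] i \<otimes> y [^] Suc j \<otimes> ?z"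
    using x y by (simp add: m_ac)
  finally show ?case
    using Suc.IH[of "Suc i" j] Suc.IH[of i "Suc j"] Suc.prems
      additive_subgroup.a_closed[OF ideal.axioms(1)[OF I]] by simp
qed

lemma (in cring) radical_ideal:
  assumes I: "ideal I R"
  shows "ideal (radical R I) R"
proof -
  have mult: "a \<otimes> x \<in> radical R I" if "x \<in> radical R I" "a \<in> carrier R" for a x
  proof -
    from that(1) obtain n where "x \<in> carrier R" "n > 0" "x [^] (n::nat) \<in> I"
      by (rule radicalE)
    thus ?thesis
      using that(2) I by (intro radicalI[of _ _ n]) (auto simp: nat_pow_distrib ideal.I_l_closed)
  qed
  have add: "x \<oplus> y \<in> radical R I" if "x \<in> radical R I" "y \<in> radical R I" for x y
  proof -
    from that(1) obtain n where n: "x \<in> carrier R" "n > 0" "x [^] (n::nat) \<in> I"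
      by (rule radicalE)
    from that(2) obtain m where m: "y \<in> carrier R" "m > 0" "y [^] (m::nat) \<in> I"
      by (rule radicalE)
    \<comment> \<open>With \<open>i = j = 0\<close> the monomial in front is 1 and only the power of
      the sum remains.\<close>
    show ?thesis
      using ideal_pow_add[OF I n(1) m(1) n(3) m(3), of 0 0 "n + m"] n m
      by (intro radicalI[of _ _ "n + m"]) auto
  qed
  have sub: "radical R I \<subseteq> carrier R"
    unfolding radical_def by blast
  have neg: "\<ominus> x \<in> radical R I" if "x \<in> radical R I" for x
    using mult[OF that, of "\<ominus> \<one>"] sub that by (auto simp: l_minus)
  show ?thesis
  proof (rule idealI)
    show "ring R" by (rule ring_axioms)
    show "subgroup (radical R I) (add_monoid R)"
      using sub neg add subset_radical[OF I] additive_subgroup.zero_closed[OF ideal.axioms(1)[OF I]]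
      by (intro add.subgroupI) (auto simp: a_inv_def)
    show "x \<otimes> a \<in> radical R I" if "a \<in> radical R I" "x \<in> carrier R" for a x
      using mult that .
    show "a \<otimes> x \<in> radical R I" if "a \<in> radical R I" "x \<in> carrier R" for a x
      using mult[OF that] sub that by (auto simp: m_comm)
  qed
qed

lemma (in cring) cgenideal_inter_subset_radical:
  assumes f: "f \<in> carrier R" and g: "g \<in> carrier R"
  shows "PIdl f \<inter> PIdl g \<subseteq> radical R (PIdl (f \<otimes> g))"
proof
  fix x assume "x \<in> PIdl f \<inter> PIdl g"
  then obtain a b where a: "a \<in> carrier R" "x = a \<otimes> f" and b: "b \<in> carrier R" "x = b \<otimes> g"
    unfolding cgenideal_def by blast
  have x: "x \<in> carrier R" using a f by simp
  have "x [^] (2::nat) = x \<otimes> x" using x by (simp add: numeral_2_eq_2)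
  also have "\<dots> = (a \<otimes> f) \<otimes> (b \<otimes> g)" using a(2) b(2) by simp
  also have "\<dots> = (a \<otimes> b) \<otimes> (f \<otimes> g)" using a(1) b(1) f g by (simp add: m_ac)
  finally have "x [^] (2::nat) \<in> PIdl (f \<otimes> g)"
    using a(1) b(1) unfolding cgenideal_def by blast
  with x show "x \<in> radical R (PIdl (f \<otimes> g))"
    by (intro radicalI[of _ _ 2]) auto
qed

section \<open>Extended ideals and contents along a ring homomorphism\<close>

context ring_hom_cring
begin

lemma ideal_ext_ideal:
  assumes "ideal I R"
  shows "ideal (ideal_ext S h I) S"
  unfolding ideal_ext_def using assms by (intro S.genideal_ideal) (auto simp: ideal.Icarr)

lemma hom_mem_ideal_ext: "a \<in> I \<Longrightarrow> h a \<in> ideal_ext S h I"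
  unfolding ideal_ext_def genideal_def by blast

lemma ideal_ext_mono: "I \<subseteq> J \<Longrightarrow> ideal_ext S h I \<subseteq> ideal_ext S h J"
  unfolding ideal_ext_def genideal_def using image_mono[of I J h] by blast

lemma ideal_ext_carrier: "ideal_ext S h (carrier R) = carrier S"
  using ideal.one_imp_carrier[OF ideal_ext_ideal[OF R.oneideal]]
    hom_mem_ideal_ext[OF R.one_closed] by simp

text \<open>Extensions are given only by generators, so the factors are treated one at a time. The
  elements that a fixed element multiplies into \<open>?E\<close> form a colon ideal, hence it is
  enough to test generators: first \<open>h b\<close> against \<open>h a\<close>, then
  \<open>h a\<close> against \<open>g\<close>.\<close>

lemma ideal_ext_mult:
  assumes I: "ideal I R" and J: "ideal J R"
    and f: "f \<in> ideal_ext S h I" and g: "g \<in> ideal_ext S h J"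
  shows "f \<otimes>\<^bsub>S\<^esub> g \<in> ideal_ext S h (ideal_prod R I J)"
proof -
  let ?E = "ideal_ext S h (ideal_prod R I J)"
  have E: "ideal ?E S"
    using I J by (intro ideal_ext_ideal R.ideal_prod_is_ideal)
  have gc: "g \<in> carrier S"
    using ideal.Icarr[OF ideal_ext_ideal[OF J] g] .
  have *: "h a \<otimes>\<^bsub>S\<^esub> g \<in> ?E" if a: "a \<in> I" for a
  proof -
    have ac: "a \<in> carrier R" using ideal.Icarr[OF I a] .
    have "h a \<otimes>\<^bsub>S\<^esub> h b \<in> ?E" if b: "b \<in> J" for b
      using hom_mem_ideal_ext[OF ideal_prod.prod[OF a b, of R]]
        ac ideal.Icarr[OF J b] by simp
    hence "h ` J \<subseteq> {x \<in> carrier S. h a \<otimes>\<^bsub>S\<^esub> x \<in> ?E}"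
      using J by (auto simp: ideal.Icarr)
    hence "ideal_ext S h J \<subseteq> {x \<in> carrier S. h a \<otimes>\<^bsub>S\<^esub> x \<in> ?E}"
      unfolding ideal_ext_def[of S h J]
      using E ac by (intro S.genideal_minimal ideal.helper_max_prime S.is_cring) auto
    with g show ?thesis by blast
  qed
  have "h ` I \<subseteq> {x \<in> carrier S. g \<otimes>\<^bsub>S\<^esub> x \<in> ?E}"
    using * I gc by (auto simp: ideal.Icarr S.m_comm)
  hence "ideal_ext S h I \<subseteq> {x \<in> carrier S. g \<otimes>\<^bsub>S\<^esub> x \<in> ?E}"
    unfolding ideal_ext_def[of S h I]
    using E gc by (intro S.genideal_minimal ideal.helper_max_prime S.is_cring) auto
  with f gc show ?thesis by (auto simp: S.m_comm)
qed

lemma content_is_ideal: "f \<in> carrier S \<Longrightarrow> ideal (content R S h f) R"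
  unfolding content_def by (rule R.i_Intersect) (use R.oneideal ideal_ext_carrier in auto)

lemma content_ideal_is_ideal:
  assumes "ideal J S"
  shows "ideal (content_ideal R S h J) R"
proof -
  have "J \<subseteq> ideal_ext S h (carrier R)"
    using ideal.Icarr[OF assms] ideal_ext_carrier by blast
  thus ?thesis
    unfolding content_ideal_def by (intro R.i_Intersect) (use R.oneideal in auto)
qed

lemma content_subset: "ideal I R \<Longrightarrow> f \<in> ideal_ext S h I \<Longrightarrow> content R S h f \<subseteq> I"
  unfolding content_def by blast

lemma content_subset_content_ideal: "f \<in> J \<Longrightarrow> content R S h f \<subseteq> content_ideal R S h J"
  unfolding content_def content_ideal_def by blast

lemma content_ideal_mono: "I \<subseteq> J \<Longrightarrow> content_ideal R S h I \<subseteq> content_ideal R S h J"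
  unfolding content_ideal_def by blast

text \<open>An ideal contains \<open>f\<close> exactly when it contains all multiples of
  \<open>f\<close>, so both intersections run over the same family.\<close>

lemma content_ideal_cgenideal:
  assumes f: "f \<in> carrier S"
  shows "content_ideal R S h (PIdl\<^bsub>S\<^esub> f) = content R S h f"
proof -
  have "PIdl\<^bsub>S\<^esub> f \<subseteq> ideal_ext S h I \<longleftrightarrow> f \<in> ideal_ext S h I" if "ideal I R" for I
    using S.cgenideal_minimal[OF ideal_ext_ideal[OF that]] S.cgenideal_self[OF f] by blast
  thus ?thesis unfolding content_def content_ideal_def by (intro arg_cong[of _ _ Inter]) blast
qed

end

section \<open>Contents in Ohm-Rush algebras\<close>

context ohm_rush_algebra
begin

text \<open>The Ohm-Rush property puts each \<open>f\<close> into the extension of its content,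
  hence into that of \<open>K\<close>. So \<open>K\<close> is one of the ideals intersected, and
  bounds on the content of an ideal can be checked elementwise.\<close>

lemma content_ideal_subset:
  assumes "ideal J S" "ideal K R" "\<And>f. f \<in> J \<Longrightarrow> content R S h f \<subseteq> K"
  shows "content_ideal R S h J \<subseteq> K"
proof -
  have "f \<in> ideal_ext S h K" if "f \<in> J" for f
    using mem_content_ext[OF ideal.Icarr[OF assms(1) that]] ideal_ext_mono[OF assms(3)[OF that]]
    by (rule rev_subsetD)
  hence "J \<subseteq> ideal_ext S h K" by (rule subsetI)
  with assms(2) show ?thesis unfolding content_ideal_def by (intro Inter_lower) simp
qed

text \<open>This half of the weak content equation holds in every Ohm-Rush algebra, even without
  radicals.\<close>

lemma content_mult_subset:
  assumes f: "f \<in> carrier S" and g: "g \<in> carrier S"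
  shows "content R S h (f \<otimes>\<^bsub>S\<^esub> g) \<subseteq> ideal_prod R (content R S h f) (content R S h g)"
proof (rule content_subset)
  note ideals = content_is_ideal[OF f] content_is_ideal[OF g]
  show "ideal (ideal_prod R (content R S h f) (content R S h g)) R"
    using ideals by (rule R.ideal_prod_is_ideal)
  show "f \<otimes>\<^bsub>S\<^esub> g \<in> ideal_ext S h (ideal_prod R (content R S h f) (content R S h g))"
    using ideals mem_content_ext[OF f] mem_content_ext[OF g] by (rule ideal_ext_mult)
qed

end

section \<open>From weak content to power-content and the intersection property\<close>

context weak_content_algebra
begin

lemma mult_mem_radical_content:
  assumes "f \<in> carrier S" "g \<in> carrier S" "a \<in> content R S h f" "b \<in> content R S h g"
  shows "a \<otimes> b \<in> radical R (content R S h (f \<otimes>\<^bsub>S\<^esub> g))"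
  using ideal_prod.prod[OF assms(3,4)] radical_content_mult[OF assms(1,2)]
    R.subset_radical[OF R.ideal_prod_is_ideal[OF assms(1,2)[THEN content_is_ideal]]]
  by blast

text \<open>Each induction step multiplies a power of \<open>a\<close>, already in the content of a
  power of \<open>f\<close>, by one more \<open>a\<close> from the content of \<open>f\<close>. The
  form \<open>Suc n\<close> matches the positive exponents in \<open>radical\<close>.\<close>

lemma content_subset_radical_content_pow:
  assumes f: "f \<in> carrier S"
  shows "content R S h f \<subseteq> radical R (content R S h (f [^]\<^bsub>S\<^esub> Suc n))"
proof (induction n)
  case 0
  show ?case using f R.subset_radical[OF content_is_ideal[OF f]] by simp
next
  case (Suc n)
  show ?case
  proof
    fix a assume a: "a \<in> content R S h f"
    with Suc obtain k where k: "a \<in> carrier R" "a [^] (k::nat) \<in> content R S h (f [^]\<^bsub>S\<^esub> Suc n)"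
      by (meson radicalE subsetD)
    have "a [^] Suc k \<in> radical R (content R S h (f [^]\<^bsub>S\<^esub> Suc (Suc n)))"
      using mult_mem_radical_content[OF _ f k(2) a] f by simp
    with k(1) show "a \<in> radical R (content R S h (f [^]\<^bsub>S\<^esub> Suc (Suc n)))"
      by (intro R.radical_pow_mem[of a "Suc k"]) auto
  qed
qed

lemma content_ideal_radical_subset:
  assumes J: "ideal J S"
  shows "content_ideal R S h (radical S J) \<subseteq> radical R (content_ideal R S h J)"
proof (rule content_ideal_subset)
  show "ideal (radical S J) S" using J by (rule S.radical_ideal)
  show "ideal (radical R (content_ideal R S h J)) R"
    using J by (intro R.radical_ideal content_ideal_is_ideal)
next
  fix f assume "f \<in> radical S J"
  then obtain n where n: "f \<in> carrier S" "f [^]\<^bsub>S\<^esub> Suc n \<in> J"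
    by (metis radicalE gr0_implies_Suc)
  have "content R S h f \<subseteq> radical R (content R S h (f [^]\<^bsub>S\<^esub> Suc n))"
    using n(1) by (rule content_subset_radical_content_pow)
  also have "\<dots> \<subseteq> radical R (content_ideal R S h J)"
    using n(2) by (intro radical_mono content_subset_content_ideal)
  finally show "content R S h f \<subseteq> radical R (content_ideal R S h J)" .
qed

lemma content_ideal_inter_subset:
  assumes I: "ideal I S" and J: "ideal J S"
  shows "content_ideal R S h I \<inter> content_ideal R S h J
    \<subseteq> radical R (content_ideal R S h (I \<inter> J))"
proof
  let ?K = "radical R (content_ideal R S h (I \<inter> J))"
  have K: "ideal ?K R"
    using I J by (intro R.radical_ideal content_ideal_is_ideal S.i_intersect)
  \<comment> \<open>Elementwise bounds need an ideal as target. These colon ideals serve to pass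
    from contents of elements to contents of ideals, first for \<open>I\<close> and then for
    \<open>J\<close>.\<close>
  have colon: "ideal {x \<in> carrier R. a \<otimes> x \<in> ?K} R" if "a \<in> carrier R" for a
    using K that by (intro ideal.helper_max_prime R.is_cring)
  have ab: "a \<otimes> b \<in> ?K"
    if f: "f \<in> I" and g: "g \<in> J" and a: "a \<in> content R S h f" and b: "b \<in> content R S h g"
    for f g a b
  proof -
    note fg = ideal.Icarr[OF I f] ideal.Icarr[OF J g]
    have "f \<otimes>\<^bsub>S\<^esub> g \<in> I \<inter> J"
      using f g fg I J by (simp add: ideal.I_l_closed ideal.I_r_closed)
    from radical_mono[OF content_subset_content_ideal[OF this]] mult_mem_radical_content[OF fg a b]
    show ?thesis by (rule subsetD)
  qed
  have bx: "b \<otimes> x \<in> ?K"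
    if g: "g \<in> J" and b: "b \<in> content R S h g" and x: "x \<in> content_ideal R S h I" for g b x
  proof -
    have bc: "b \<in> carrier R"
      using ideal.Icarr[OF content_is_ideal[OF ideal.Icarr[OF J g]] b] .
    have "content R S h f \<subseteq> {x \<in> carrier R. b \<otimes> x \<in> ?K}" if f: "f \<in> I" for f
    proof
      fix a assume a: "a \<in> content R S h f"
      have "a \<in> carrier R"
        using ideal.Icarr[OF content_is_ideal[OF ideal.Icarr[OF I f]] a] .
      with ab[OF f g a b] bc show "a \<in> {x \<in> carrier R. b \<otimes> x \<in> ?K}"
        by (simp add: R.m_comm)
    qed
    with content_ideal_subset[OF I colon[OF bc]] x show ?thesis by blast
  qed
  fix x assume x: "x \<in> content_ideal R S h I \<inter> content_ideal R S h J"
  have xc: "x \<in> carrier R"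
    using x ideal.Icarr[OF content_ideal_is_ideal[OF I]] by blast
  have "content R S h g \<subseteq> {y \<in> carrier R. x \<otimes> y \<in> ?K}" if g: "g \<in> J" for g
  proof
    fix b assume b: "b \<in> content R S h g"
    have "b \<in> carrier R"
      using ideal.Icarr[OF content_is_ideal[OF ideal.Icarr[OF J g]] b] .
    with bx[OF g b, of x] x xc show "b \<in> {y \<in> carrier R. x \<otimes> y \<in> ?K}"
      by (simp add: R.m_comm)
  qed
  \<comment> \<open>Since \<open>x\<close> lies in both contents, it can play both factors; its
    square then suffices because \<open>?K\<close> is a radical.\<close>
  with content_ideal_subset[OF J colon[OF xc]] x have "x \<otimes> x \<in> ?K" by blast
  hence "x [^] (2::nat) \<in> ?K" using xc by (simp add: numeral_2_eq_2)
  with xc show "x \<in> ?K" by (rule R.radical_pow_mem) simp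
qed

lemma power_content: "power_content_algebra R S h"
  by unfold_locales (rule content_ideal_radical_subset)

end

section \<open>From power-content and the intersection property to weak content\<close>

lemma (in power_content_algebra) weak_contentI:
  assumes inter: "\<And>I J. ideal I S \<Longrightarrow> ideal J S \<Longrightarrow>
    content_ideal R S h I \<inter> content_ideal R S h J
      \<subseteq> radical R (content_ideal R S h (I \<inter> J))"
  shows "weak_content_algebra R S h"
proof unfold_locales
  fix f g assume f: "f \<in> carrier S" and g: "g \<in> carrier S"
  let ?P = "PIdl\<^bsub>S\<^esub> (f \<otimes>\<^bsub>S\<^esub> g)"
  have P: "ideal ?P S"
    using f g by (intro S.cgenideal_ideal) simp
  \<comment> \<open>Enlarging the product to the intersection makes \<open>inter\<close> applicable,
    once the contents are rewritten as those of principal ideals.\<close>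
  have "ideal_prod R (content R S h f) (content R S h g) \<subseteq> content R S h f \<inter> content R S h g"
    using f g by (intro R.ideal_prod_inter content_is_ideal)
  also have "\<dots> = content_ideal R S h (PIdl\<^bsub>S\<^esub> f) \<inter> content_ideal R S h (PIdl\<^bsub>S\<^esub> g)"
    using f g by (simp add: content_ideal_cgenideal)
  also have "\<dots> \<subseteq> radical R (content_ideal R S h (PIdl\<^bsub>S\<^esub> f \<inter> PIdl\<^bsub>S\<^esub> g))"
    using f g by (intro inter S.cgenideal_ideal)
  also have "\<dots> \<subseteq> radical R (content_ideal R S h (radical S ?P))"
    using f g by (intro radical_mono content_ideal_mono S.cgenideal_inter_subset_radical)
  also have "\<dots> \<subseteq> radical R (radical R (content_ideal R S h ?P))"
    by (intro radical_mono content_radical_subset P)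
  also have "\<dots> \<subseteq> radical R (content_ideal R S h ?P)"
    by (rule R.radical_radical)
  also have "\<dots> = radical R (content R S h (f \<otimes>\<^bsub>S\<^esub> g))"
    using f g by (simp add: content_ideal_cgenideal)
  finally have "radical R (ideal_prod R (content R S h f) (content R S h g))
      \<subseteq> radical R (radical R (content R S h (f \<otimes>\<^bsub>S\<^esub> g)))"
    by (rule radical_mono)
  \<comment> \<open>The chain gives the hard inclusion after the double radical collapses; the other
    one is the general Ohm-Rush bound.\<close>
  with R.radical_radical radical_mono[OF content_mult_subset[OF f g]]
  show "radical R (content R S h (f \<otimes>\<^bsub>S\<^esub> g))
      = radical R (ideal_prod R (content R S h f) (content R S h g))"
    by blast
qed

theorem proposition4p6:
  fixes R :: "('a, 'm) ring_scheme" and S :: "('b, 'n) ring_scheme" and h :: "'a \<Rightarrow> 'b"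
  assumes "ring_hom_cring R S h"
  shows "weak_content_algebra R S h \<longleftrightarrow>
    power_content_algebra R S h \<and>
    (\<forall>I J. ideal I S \<longrightarrow> ideal J S \<longrightarrow>
      content_ideal R S h I \<inter> content_ideal R S h J
        \<subseteq> radical R (content_ideal R S h (I \<inter> J)))"
  using weak_content_algebra.power_content weak_content_algebra.content_ideal_inter_subset
    power_content_algebra.weak_contentI by blast

end
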